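(* Let $E$ be a complex elliptic curve, and let $E^2=E\times E$ be endowed with a product polarization. For an integer $t\ge1$ let $N_{E^2}(t)$ be the number of elliptic curves in $E^2$ of degree $\le t$. Then there are a constant $C$ and a function $q$ of order $q(t)=O(t^2)$ such that $$N_{E^2}(t)\le C\,t^3+q(t)\qquad\text{for all integers } t\ge 1,$$ and both $C$ and $q$ can be given explicitly.
   Context: "Elliptic curve in" a complex torus $A$ means a one-dimensional complex subtorus of $A$ (so it passes through the origin). A product polarization on $E^g$ is the polarization given by the divisor $p_1^*(m_1\Theta_E)+\cdots+p_g^*(m_g\Theta_E)$, where $p_i:E^g\to E$ are the projections, $\Theta_E$ is the theta divisor of the principal polarization of $E$ (a divisor of degree one, e.g. the origin) and $m_1,\dots,m_g$ are positive integers. The degree of an elliptic curve $F\subset A$ with respect to a polarization with associated divisor $\Theta$ is the intersection number $F\cdot\Theta$. The constant $C$ and the function $q$ may depend on $E$ and on the polarization. *)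

theory Defs
  imports "HOL-Complex_Analysis.Complex_Analysis" "HOL-Library.Landau_Symbols"
begin

definition is_lattice :: "'a::euclidean_space set \<Rightarrow> bool" where
  "is_lattice L \<longleftrightarrow>
     (\<exists>B. independent B \<and> span B = UNIV \<and> L = {\<Sum>b\<in>B. of_int (n b) *\<^sub>R b |n :: 'a \<Rightarrow> int. True})"

text \<open>
  The points of the complex torus V/L are the cosets of L in V.
  The elliptic curve E is \<open>\<complex>/\<Lambda>\<close>, and its power is \<open>\<complex>\<^sup>g/\<Lambda>\<^sup>g\<close>.
\<close>

definition torus_point :: "'a::ab_group_add set \<Rightarrow> 'a \<Rightarrow> 'a set" where
  "torus_point L v = (+) v ` L"

definition power_lattice :: "complex set \<Rightarrow> (complex^'g) set" where
  "power_lattice \<Lambda> = {v. \<forall>i. v $ i \<in> \<Lambda>}"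

text \<open>
  A complex subtorus of V/L is the image of a complex subspace W such that \<open>W \<inter> L\<close> is a lattice
  in W. As \<open>W \<inter> L\<close> is discrete, the latter means that it spans W over the reals
  (\<open>span\<close> is the real span, \<open>vec.subspace\<close> and \<open>vec.dim\<close> refer to complex scalars).
\<close>

definition elliptic_curves_in :: "(complex^'g) set \<Rightarrow> (complex^'g) set set set" where
  "elliptic_curves_in L =
     {torus_point L ` W |W. vec.subspace W \<and> vec.dim W = 1 \<and> span (W \<inter> L) = W}"

text \<open>
  An effective Cartier divisor on \<open>\<complex>\<^sup>g/L\<close> is represented by its local equations: \<open>D v\<close> is, as a
  function near \<open>v\<close>, a local equation of the divisor at the image of \<open>v\<close>. Pulling back a divisor
  means composing its local equations, and adding divisors means multiplying their local equations.
\<close>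

type_synonym 'v divisor = "'v \<Rightarrow> 'v \<Rightarrow> complex"

definition origin_divisor :: "complex set \<Rightarrow> complex divisor" where
  "origin_divisor \<Lambda> u = (if u \<in> \<Lambda> then (\<lambda>z. z - u) else (\<lambda>z. 1))"

text \<open>The divisor \<open>p\<^sub>1\<^sup>*(m\<^sub>1 \<Theta>) + \<dots> + p\<^sub>g\<^sup>*(m\<^sub>g \<Theta>)\<close>, with \<open>\<Theta>\<close> the origin of E.\<close>

definition product_divisor :: "complex set \<Rightarrow> ('g \<Rightarrow> nat) \<Rightarrow> (complex^'g) divisor" where
  "product_divisor \<Lambda> m v z = (\<Prod>i\<in>UNIV. origin_divisor \<Lambda> (v $ i) (z $ i) ^ m i)"

definition divisor_support :: "(complex^'g) set \<Rightarrow> (complex^'g) divisor \<Rightarrow> (complex^'g) set set" where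
  "divisor_support L D = {torus_point L v |v. D v v = 0}"

definition translate_divisor :: "complex^'g \<Rightarrow> (complex^'g) divisor \<Rightarrow> (complex^'g) divisor" where
  "translate_divisor x D v z = D (v - x) (z - x)"

text \<open>
  Local intersection multiplicity at P of a divisor with a curve through P that is
  the image of a complex line of direction w: the order of vanishing of a local equation
  restricted to the curve.
\<close>

definition local_multiplicity :: "(complex^'g) divisor \<Rightarrow> complex^'g \<Rightarrow> (complex^'g) set \<Rightarrow> int" where
  "local_multiplicity D w P = (let v = (SOME v. v \<in> P) in zorder (\<lambda>s. D v (v + s *s w)) 0)"

text \<open>
  The intersection number of an elliptic curve F with D. As F may be a component of D, the divisor is
  first replaced by an algebraically equivalent translate that does not contain F; the number
  obtained does not depend on the translate. The set of points summed over is finite, since F is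
  compact and not contained in the translate.
\<close>

definition intersection_number ::
  "(complex^'g) set \<Rightarrow> (complex^'g) set set \<Rightarrow> (complex^'g) divisor \<Rightarrow> int" where
  "intersection_number L F D =
     (THE n. \<exists>w x. w \<noteq> 0 \<and> F = torus_point L ` {s *s w |s. True} \<and>
        \<not> F \<subseteq> divisor_support L (translate_divisor x D) \<and>
        n = (\<Sum>P\<in>F \<inter> divisor_support L (translate_divisor x D).
               local_multiplicity (translate_divisor x D) w P))"

definition elliptic_curves_of_degree_le ::
  "complex set \<Rightarrow> ('g \<Rightarrow> nat) \<Rightarrow> nat \<Rightarrow> (complex^'g) set set set" where
  "elliptic_curves_of_degree_le \<Lambda> m t =
     {F \<in> elliptic_curves_in (power_lattice \<Lambda>).
        intersection_number (power_lattice \<Lambda>) F (product_divisor \<Lambda> m) \<le> int t}"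

end

theory Submission
  imports Defs
begin

text \<open>
  A curve that is not a coordinate axis is the image of a line of direction w with \<open>w\<^sub>1, w\<^sub>2 \<noteq> 0\<close>. If
  \<open>d\<^sub>i\<close> is the degree of its projection to the i-th factor, then its degree is \<open>m\<^sub>1 d\<^sub>1 + m\<^sub>2 d\<^sub>2\<close>.
  By Lagrange's theorem \<open>\<alpha> = d\<^sub>1 w\<^sub>2/w\<^sub>1\<close> is an endomorphism of E, and comparing areas of fundamental
  domains gives \<open>|\<alpha>|\<^sup>2 = d\<^sub>1 d\<^sub>2\<close>. With \<open>T = t/\<surd>(m\<^sub>1 m\<^sub>2)\<close> the inequality of arithmetic and geometric means
  yields \<open>|\<alpha>| \<le> T/2\<close>, and if \<open>m\<^sub>1 \<ge> m\<^sub>2\<close>, as one may assume, then \<open>d\<^sub>1 \<le> t/m\<^sub>1 \<le> T\<close>. Since nonzero endomorphisms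
  have modulus at least 1, discs of radius 1/2 around them are disjoint, so there are at most
  \<open>(T + 1)\<^sup>2 - 1\<close> choices of \<open>\<alpha> \<noteq> 0\<close>. The pair \<open>(d\<^sub>1, \<alpha>)\<close> determines the line, which leaves at most
  \<open>T ((T + 1)\<^sup>2 - 1) + 2\<close> curves.
\<close>

section \<open>Lattices and fundamental domains\<close>

text \<open>This weak notion covers lattices together with \<open>periods\<close> and
  \<open>coordinate_periods\<close>, for which no integral basis is constructed; finite index,
  cosets and areas are all handled at this level.\<close>

definition add_subgroup :: "'a::ab_group_add set \<Rightarrow> bool" where
  "add_subgroup G \<longleftrightarrow> 0 \<in> G \<and> (\<forall>x\<in>G. \<forall>y\<in>G. x - y \<in> G)"

lemma add_subgroup_zero: "add_subgroup G \<Longrightarrow> 0 \<in> G"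
  and add_subgroup_diff: "add_subgroup G \<Longrightarrow> x \<in> G \<Longrightarrow> y \<in> G \<Longrightarrow> x - y \<in> G"
  by (auto simp: add_subgroup_def)

lemma add_subgroup_uminus: "add_subgroup G \<Longrightarrow> x \<in> G \<Longrightarrow> - x \<in> G"
  using add_subgroup_diff[of G 0 x] by (simp add: add_subgroup_zero)

lemma add_subgroup_add: "add_subgroup G \<Longrightarrow> x \<in> G \<Longrightarrow> y \<in> G \<Longrightarrow> x + y \<in> G"
  using add_subgroup_diff[of G x "- y"] by (simp add: add_subgroup_uminus)

lemma add_subgroup_sum:
  "add_subgroup G \<Longrightarrow> (\<And>i. i \<in> I \<Longrightarrow> f i \<in> G) \<Longrightarrow> (\<Sum>i\<in>I. f i) \<in> G"
  by (induction I rule: infinite_finite_induct) (auto simp: add_subgroup_zero add_subgroup_add)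

lemma add_subgroup_of_int_scaleR:
  fixes x :: "'a::real_vector"
  assumes "add_subgroup G" "x \<in> G"
  shows "of_int n *\<^sub>R x \<in> G"
proof -
  have nat: "real k *\<^sub>R x \<in> G" for k
    by (induction k) (auto simp: assms add_subgroup_zero add_subgroup_add scaleR_add_left)
  show ?thesis
    using nat[of "nat n"] add_subgroup_uminus[OF assms(1) nat[of "nat (- n)"]]
    by (cases "n \<ge> 0") auto
qed

lemma torus_point_eq_iff:
  assumes "add_subgroup G"
  shows "torus_point G v = torus_point G w \<longleftrightarrow> v - w \<in> G"
proof
  assume "torus_point G v = torus_point G w"
  moreover have "v \<in> torus_point G v"
    using add_subgroup_zero[OF assms] by (auto simp: torus_point_def image_iff)
  ultimately show "v - w \<in> G" by (auto simp: torus_point_def)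
next
  have *: "torus_point G v \<subseteq> torus_point G w" if "v - w \<in> G" for v w
  proof
    fix z assume "z \<in> torus_point G v"
    then have "z - v \<in> G" by (auto simp: torus_point_def)
    then have "(z - v) + (v - w) \<in> G" using that add_subgroup_add[OF assms] by blast
    then show "z \<in> torus_point G w" by (auto simp: torus_point_def image_iff intro!: bexI[of _ "z - w"])
  qed
  assume "v - w \<in> G"
  moreover have "w - v \<in> G" using add_subgroup_uminus[OF assms calculation] by simp
  ultimately show "torus_point G v = torus_point G w" using * by blast
qed

section \<open>Coordinates and discreteness of lattices\<close>

text \<open>The dual basis turns membership in L into integrality of finitely many linear
  functionals, so that later arguments can round coordinates instead of manipulating integral
  combinations.\<close>

lemma lattice_coordinates:
  fixes L :: "'a::euclidean_space set"
  assumes "is_lattice L"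
  obtains B :: "'a set" and c where "finite B" "\<And>b. linear (c b)"
    "\<And>v. v = (\<Sum>b\<in>B. c b v *\<^sub>R b)" "\<And>b x. b \<in> B \<Longrightarrow> c b (\<Sum>b\<in>B. x b *\<^sub>R b) = x b"
    "L = {v. \<forall>b\<in>B. c b v \<in> \<int>}"
proof -
  obtain B where B: "independent B" "span B = UNIV"
    and L: "L = {\<Sum>b\<in>B. of_int (n b) *\<^sub>R b |n :: 'a \<Rightarrow> int. True}"
    using assms by (auto simp: is_lattice_def)
  define c where "c b v = representation B v b" for b v
  have fin: "finite B" using B(1) by (rule finiteI_independent)
  have lin: "linear (c b)" for b
    unfolding c_def using bounded_linear_representation[OF B] by (rule bounded_linear.linear)
  have repr: "v = (\<Sum>b\<in>B. c b v *\<^sub>R b)" for v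
    unfolding c_def using sum_representation_eq[OF B(1) _ fin subset_refl, of v] B(2) by simp
  have coord: "c b (\<Sum>b\<in>B. x b *\<^sub>R b) = x b" if "b \<in> B" for b x
  proof -
    have "c b (\<Sum>b\<in>B. x b *\<^sub>R b) = (\<Sum>b'\<in>B. x b' * c b b')"
      by (simp add: linear_sum[OF lin] linear_scale[OF lin])
    also have "\<dots> = (\<Sum>b'\<in>B. if b' = b then x b' else 0)"
      by (rule sum.cong) (auto simp: c_def representation_basis[OF B(1)])
    finally show ?thesis using that fin by simp
  qed
  have "L = {v. \<forall>b\<in>B. c b v \<in> \<int>}"
  proof (intro set_eqI iffI)
    fix v assume "v \<in> L"
    then show "v \<in> {v. \<forall>b\<in>B. c b v \<in> \<int>}" using coord by (auto simp: L)
  next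
    fix v assume "v \<in> {v. \<forall>b\<in>B. c b v \<in> \<int>}"
    then have "\<forall>b\<in>B. of_int \<lfloor>c b v\<rfloor> = c b v" by auto
    then have "(\<Sum>b\<in>B. of_int \<lfloor>c b v\<rfloor> *\<^sub>R b) = v" by (subst (2) repr) (auto intro: sum.cong)
    then show "v \<in> L" unfolding L by (intro CollectI exI[of _ "\<lambda>b. \<lfloor>c b v\<rfloor>"]) simp
  qed
  with that[OF fin lin repr coord] show ?thesis by blast
qed

lemma lattice_add_subgroup: "is_lattice L \<Longrightarrow> add_subgroup L"
  by (erule lattice_coordinates) (auto simp: add_subgroup_def linear_0 linear_diff)

text \<open>Linear functionals are bounded, so a lattice vector of norm at most r has integer
  coordinates in a fixed finite box.\<close>

lemma finite_lattice_Int_cball: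
  fixes L :: "'a::euclidean_space set"
  assumes "is_lattice L"
  shows "finite (L \<inter> cball 0 r)"
proof -
  obtain B c where fin: "finite B" and lin: "\<And>b. linear (c b)"
    and repr: "\<And>v::'a. v = (\<Sum>b\<in>B. c b v *\<^sub>R b)"
    and coord: "\<And>b x. b \<in> B \<Longrightarrow> c b (\<Sum>b\<in>B. x b *\<^sub>R b) = x b"
    and L: "L = {v. \<forall>b\<in>B. c b v \<in> \<int>}"
    by (rule lattice_coordinates[OF assms]) (rule that; assumption)
  obtain K where K: "\<And>b v. \<bar>c b v\<bar> \<le> K b * norm v"
    using linear_bounded[OF lin] by (metis real_norm_def)
  define N where "N b = \<lceil>\<bar>K b\<bar> * r\<rceil>" for b
  have "L \<inter> cball 0 r \<subseteq> (\<lambda>n. \<Sum>b\<in>B. of_int (n b) *\<^sub>R b) ` PiE B (\<lambda>b. {- N b..N b})"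
  proof
    fix v assume v: "v \<in> L \<inter> cball 0 r"
    have "\<lfloor>c b v\<rfloor> \<in> {- N b..N b}" if "b \<in> B" for b
    proof -
      have "of_int \<lfloor>c b v\<rfloor> = c b v" using v that by (auto simp: L)
      moreover have "\<bar>c b v\<bar> \<le> \<bar>K b\<bar> * r"
        using v by (intro order_trans[OF K[of b v]] mult_mono) auto
      ultimately show ?thesis unfolding N_def by simp linarith
    qed
    then have "(\<lambda>b\<in>B. \<lfloor>c b v\<rfloor>) \<in> PiE B (\<lambda>b. {- N b..N b})" by auto
    moreover have "v = (\<Sum>b\<in>B. of_int ((\<lambda>b\<in>B. \<lfloor>c b v\<rfloor>) b) *\<^sub>R b)"
      using v by (subst repr) (auto intro!: sum.cong simp: L)
    ultimately show "v \<in> (\<lambda>n. \<Sum>b\<in>B. of_int (n b) *\<^sub>R b) ` PiE B (\<lambda>b. {- N b..N b})"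
      by blast
  qed
  moreover have "finite (PiE B (\<lambda>b. {- N b..N b}))" using fin by (intro finite_PiE) auto
  ultimately show ?thesis using finite_surj by blast
qed

lemma countable_lattice:
  fixes L :: "'a::euclidean_space set"
  assumes "is_lattice L"
  shows "countable L"
proof -
  have "L = (\<Union>n. L \<inter> cball 0 (real n))" by (auto intro: real_arch_simple)
  then show ?thesis using finite_lattice_Int_cball[OF assms]
    by (metis countable_UN countable_finite countableI_type)
qed

section \<open>Fundamental domains and their volumes\<close>

text \<open>Uniqueness is required at every point and not just almost everywhere, so translates of D
  form a genuine partition of the space.\<close>

definition fundamental_domain :: "'a::euclidean_space set \<Rightarrow> 'a set \<Rightarrow> bool" where
  "fundamental_domain G D \<longleftrightarrow> D \<in> sets borel \<and> (\<forall>z. \<exists>!g. g \<in> G \<and> z - g \<in> D)"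

text \<open>The half-open parallelepiped on a basis works: the only lattice vector that moves z into
  it is obtained by rounding the coordinates of z down.\<close>

lemma lattice_fundamental_domain:
  fixes L :: "'a::euclidean_space set"
  assumes "is_lattice L"
  obtains P where "fundamental_domain L P" "bounded P"
proof -
  obtain B c where fin: "finite B" and lin: "\<And>b. linear (c b)"
    and repr: "\<And>v::'a. v = (\<Sum>b\<in>B. c b v *\<^sub>R b)"
    and coord: "\<And>b x. b \<in> B \<Longrightarrow> c b (\<Sum>b\<in>B. x b *\<^sub>R b) = x b"
    and L: "L = {v. \<forall>b\<in>B. c b v \<in> \<int>}"
    by (rule lattice_coordinates[OF assms]) (rule that; assumption)
  define P where "P = {v. \<forall>b\<in>B. c b v \<in> {0..<1}}"
  have "c b \<in> borel_measurable borel" for b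
    using lin by (intro borel_measurable_continuous_onI linear_continuous_on)
      (simp add: linear_conv_bounded_linear)
  then have "c b -` {0..<1} \<in> sets borel" for b
    using measurable_sets[of "c b" borel borel "{0..<1}"] by simp
  moreover have "P = (\<Inter>b\<in>B. c b -` {0..<1})" by (auto simp: P_def)
  ultimately have "P \<in> sets borel" using fin by (cases "B = {}") auto
  moreover have "\<exists>!g. g \<in> L \<and> z - g \<in> P" for z
  proof (rule ex1I)
    let ?g = "\<Sum>b\<in>B. of_int \<lfloor>c b z\<rfloor> *\<^sub>R b"
    show "?g \<in> L \<and> z - ?g \<in> P"
      by (auto simp: L P_def coord linear_diff[OF lin]) linarith
    fix g assume g: "g \<in> L \<and> z - g \<in> P"
    have "c b g = of_int \<lfloor>c b z\<rfloor>" if "b \<in> B" for b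
    proof -
      have "c b g \<in> \<int>" "c b z - c b g \<in> {0..<1}" using g that by (auto simp: L P_def linear_diff[OF lin])
      then show ?thesis by (auto elim!: Ints_cases) linarith
    qed
    then show "g = ?g" by (subst repr) (auto intro: sum.cong)
  qed
  moreover have "bounded P"
  proof -
    have "norm v \<le> (\<Sum>b\<in>B. norm b)" if "v \<in> P" for v
    proof -
      have "norm v \<le> (\<Sum>b\<in>B. norm (c b v *\<^sub>R b))" by (subst repr) (rule norm_sum)
      also have "\<dots> \<le> (\<Sum>b\<in>B. norm b)"
        using that by (intro sum_mono) (auto simp: P_def intro!: mult_left_le_one_le)
      finally show ?thesis .
    qed
    then show ?thesis by (auto simp: bounded_iff)
  qed
  ultimately show ?thesis using that by (auto simp: fundamental_domain_def)
qed

lemma borel_translate: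
  fixes X :: "'a::euclidean_space set"
  assumes "X \<in> sets borel"
  shows "(+) c -` X \<in> sets borel"
  using measurable_sets[OF _ assms, of "(+) c" borel] by simp

lemma emeasure_lborel_translate:
  fixes X :: "'a::euclidean_space set"
  assumes "X \<in> sets borel"
  shows "emeasure lborel ((+) c -` X) = emeasure lborel X"
proof -
  have "emeasure lborel X = emeasure (distr lborel borel ((+) c)) X" by (simp add: lborel_distr_plus)
  then show ?thesis using assms by (simp add: emeasure_distr)
qed

text \<open>Cut D according to the g that moves a point into D'. Translating the piece
  \<open>X g\<close> by -g gives the piece \<open>Y g\<close> of D', and translations preserve
  volume. Countability of G allows the pieces to be summed.\<close>

lemma emeasure_fundamental_domain_eq:
  assumes "countable G" "add_subgroup G" "fundamental_domain G D" "fundamental_domain G D'"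
  shows "emeasure lborel D = emeasure lborel D'"
proof -
  have [measurable]: "D \<in> sets borel" "D' \<in> sets borel"
    using assms by (auto simp: fundamental_domain_def)
  define X where "X g = D \<inter> (+) (- g) -` D'" for g
  define Y where "Y g = D' \<inter> (+) g -` D" for g
  have [measurable]: "X g \<in> sets borel" "Y g \<in> sets borel" for g
    by (auto simp: X_def Y_def intro: borel_translate)
  have eq: "emeasure lborel (X g) = emeasure lborel (Y g)" for g
  proof -
    have "Y g = (+) g -` X g" by (auto simp: X_def Y_def)
    then show ?thesis by (simp add: emeasure_lborel_translate)
  qed
  have "D = (\<Union>g\<in>G. X g)"
    using assms(4) by (fastforce simp: X_def fundamental_domain_def)
  moreover have "D' = (\<Union>g\<in>G. Y g)"
  proof -
    have "\<exists>g\<in>G. g + z \<in> D" for z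
    proof -
      obtain h where "h \<in> G" "z - h \<in> D" using assms(3) by (fastforce simp: fundamental_domain_def)
      then show ?thesis using add_subgroup_uminus[OF assms(2)] by (intro bexI[of _ "- h"]) auto
    qed
    then show ?thesis by (auto simp: Y_def)
  qed
  moreover have "disjoint_family_on X G"
    using assms(4) by (fastforce simp: disjoint_family_on_def X_def fundamental_domain_def)
  moreover have "disjoint_family_on Y G"
  proof -
    have "g = h" if "g \<in> G" "h \<in> G" "g + z \<in> D" "h + z \<in> D" for g h z
    proof -
      have "- g \<in> G \<and> z - (- g) \<in> D" "- h \<in> G \<and> z - (- h) \<in> D"
        using that add_subgroup_uminus[OF assms(2)] by (auto simp: add.commute)
      then have "- g = - h" using assms(3) unfolding fundamental_domain_def by blast
      then show ?thesis by simp
    qed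
    then show ?thesis by (auto simp: disjoint_family_on_def Y_def)
  qed
  ultimately show ?thesis
    using emeasure_UN_countable[of G X lborel] emeasure_UN_countable[of G Y lborel] assms(1)
    by (simp add: eq)
qed

text \<open>Otherwise countably many null translates of D would cover the whole space.\<close>

lemma emeasure_fundamental_domain_pos:
  assumes "countable G" "fundamental_domain G D"
  shows "emeasure lborel D > 0"
proof (rule ccontr)
  have D [measurable]: "D \<in> sets borel" using assms by (auto simp: fundamental_domain_def)
  note m = borel_translate[OF D]
  assume "\<not> emeasure lborel D > 0"
  then have "emeasure lborel ((+) (- g) -` D) = 0" for g by (simp add: emeasure_lborel_translate)
  then have "(\<Union>g\<in>G. (+) (- g) -` D) \<in> null_sets lborel"
    using assms(1) m by (intro null_sets_UN') auto
  moreover have "(\<Union>g\<in>G. (+) (- g) -` D) = UNIV"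
    using assms(2) by (fastforce simp: fundamental_domain_def)
  ultimately show False by auto
qed

lemma fundamental_domain_finite_index:
  assumes "add_subgroup A" "add_subgroup G" "G \<subseteq> A" "fundamental_domain A D"
    and fin: "finite (torus_point G ` A)"
  obtains D' where "fundamental_domain G D'"
    "emeasure lborel D' = of_nat (card (torus_point G ` A)) * emeasure lborel D"
proof -
  have D [measurable]: "D \<in> sets borel" using assms by (auto simp: fundamental_domain_def)
  note m = borel_translate[OF D]
  define Q where "Q = torus_point G ` A"
  define r where "r q = (SOME a. a \<in> A \<and> torus_point G a = q)" for q
  have r: "r q \<in> A" "torus_point G (r q) = q" if "q \<in> Q" for q
    unfolding r_def using someI_ex[of "\<lambda>a. a \<in> A \<and> torus_point G a = q"] that by (auto simp: Q_def)
  define D' where "D' = (\<Union>q\<in>Q. (+) (- r q) -` D)"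
  have unique: "a = b" if "a \<in> A" "b \<in> A" "z - a \<in> D" "z - b \<in> D" for a b z
    using that assms(4) by (auto simp: fundamental_domain_def)
  have "fundamental_domain G D'"
    unfolding fundamental_domain_def
  proof (intro conjI allI)
    show "D' \<in> sets borel" unfolding D'_def using fin m by (intro sets.finite_UN) (auto simp: Q_def)
    fix z
    obtain a where a: "a \<in> A" "z - a \<in> D" using assms(4) unfolding fundamental_domain_def by metis
    define q where "q = torus_point G a"
    have q: "q \<in> Q" using a by (auto simp: q_def Q_def)
    show "\<exists>!g. g \<in> G \<and> z - g \<in> D'"
    proof (rule ex1I)
      \<comment> \<open>Here a is the element of A that moves z into D. Its difference from the
        representative of its coset lies in G and moves z into the translate of D by
        \<open>r q\<close>.\<close>
      show "a - r q \<in> G \<and> z - (a - r q) \<in> D'"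
        using r[OF q] q a torus_point_eq_iff[OF assms(2), of a "r q"]
        by (auto simp: q_def D'_def algebra_simps intro!: bexI[of _ q])
      fix g assume g: "g \<in> G \<and> z - g \<in> D'"
      then obtain p where p: "p \<in> Q" "z - (g + r p) \<in> D" by (auto simp: D'_def algebra_simps)
      then have "a = g + r p"
        using a g r[OF p(1)] assms(3) add_subgroup_add[OF assms(1)] by (intro unique) auto
      moreover from this have "p = q"
        using torus_point_eq_iff[OF assms(2), of a "r p"] g r[OF p(1)] by (auto simp: q_def)
      ultimately show "g = a - r q" by simp
    qed
  qed
  moreover have "emeasure lborel D' = (\<Sum>q\<in>Q. emeasure lborel ((+) (- r q) -` D))"
    unfolding D'_def
  proof (rule sum_emeasure[symmetric])
    have "p = q" if "p \<in> Q" "q \<in> Q" "z - r p \<in> D" "z - r q \<in> D" for p q z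
      using unique[of "r p" "r q" z] r that by metis
    then show "disjoint_family_on (\<lambda>q. (+) (- r q) -` D) Q"
      by (fastforce simp: disjoint_family_on_def)
  qed (use fin m in \<open>auto simp: Q_def\<close>)
  then have "emeasure lborel D' = of_nat (card Q) * emeasure lborel D"
    by (simp add: emeasure_lborel_translate)
  ultimately show ?thesis using that by (auto simp: Q_def)
qed

section \<open>Subgroups of finite index\<close>

text \<open>Lagrange's theorem for A/G, written additively. Adding a permutes the cosets; the
  elements \<open>(r q + a) - r (\<sigma> q)\<close> lie in G, and in their sum the representatives
  cancel, leaving a times the index.\<close>

lemma index_scaleR_mem:
  fixes a :: "'a::real_vector"
  assumes A: "add_subgroup A" and G: "add_subgroup G" and "G \<subseteq> A"
    and fin: "finite (torus_point G ` A)" and a: "a \<in> A"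
  shows "real (card (torus_point G ` A)) *\<^sub>R a \<in> G"
proof -
  define Q where "Q = torus_point G ` A"
  define r where "r q = (SOME a. a \<in> A \<and> torus_point G a = q)" for q
  have r: "r q \<in> A" "torus_point G (r q) = q" if "q \<in> Q" for q
    unfolding r_def using someI_ex[of "\<lambda>a. a \<in> A \<and> torus_point G a = q"] that by (auto simp: Q_def)
  define \<sigma> where "\<sigma> q = torus_point G (r q + a)" for q
  have \<sigma>: "\<sigma> q \<in> Q" if "q \<in> Q" for q
    using r[OF that] a add_subgroup_add[OF A] by (auto simp: \<sigma>_def Q_def)
  have "inj_on \<sigma> Q"
  proof (rule inj_onI)
    fix p q assume pq: "p \<in> Q" "q \<in> Q" "\<sigma> p = \<sigma> q"
    then have "r p - r q \<in> G" by (simp add: \<sigma>_def torus_point_eq_iff[OF G])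
    then show "p = q" using r pq torus_point_eq_iff[OF G] by metis
  qed
  then have "bij_betw \<sigma> Q Q"
    using \<sigma> fin by (simp add: bij_betw_def Q_def endo_inj_surj image_subset_iff)
  then have "(\<Sum>q\<in>Q. r (\<sigma> q)) = (\<Sum>q\<in>Q. r q)"
    by (rule sum.reindex_bij_betw)
  then have "(\<Sum>q\<in>Q. (r q + a) - r (\<sigma> q)) = real (card Q) *\<^sub>R a"
    by (simp add: sum.distrib sum_subtractf sum_constant_scaleR)
  moreover have "(r q + a) - r (\<sigma> q) \<in> G" if "q \<in> Q" for q
    using r[OF \<sigma>[OF that]] by (simp flip: torus_point_eq_iff[OF G] add: \<sigma>_def)
  ultimately show ?thesis
    using add_subgroup_sum[OF G, of Q "\<lambda>q. (r q + a) - r (\<sigma> q)"] by (simp add: Q_def)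
qed

text \<open>Choose a real basis inside G and subtract the integer parts of the coordinates. Every
  coset then has a representative in one fixed ball, which contains only finitely many elements of
  A.\<close>

lemma finite_index:
  fixes A G :: "'a::euclidean_space set"
  assumes A: "add_subgroup A" and G: "add_subgroup G" and "G \<subseteq> A" and span: "span G = UNIV"
    and discrete: "\<And>r. finite (A \<inter> cball 0 r)"
  shows "finite (torus_point G ` A)"
proof -
  obtain B where B: "B \<subseteq> G" "independent B" "G \<subseteq> span B"
    by (rule maximal_independent_subset)
  have fin: "finite B" using B(2) by (rule finiteI_independent)
  have spanB: "span B = UNIV" using span span_mono[OF B(3)] by (simp add: span_span top.extremum_uniqueI)
  define R where "R = (\<Sum>b\<in>B. norm b)"
  have "torus_point G ` A \<subseteq> torus_point G ` (A \<inter> cball 0 R)"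
  proof (rule image_subsetI)
    fix a assume a: "a \<in> A"
    define c where "c = representation B a"
    define g where "g = (\<Sum>b\<in>B. of_int \<lfloor>c b\<rfloor> *\<^sub>R b)"
    have "a = (\<Sum>b\<in>B. c b *\<^sub>R b)"
      unfolding c_def using sum_representation_eq[OF B(2) _ fin subset_refl, of a] spanB by simp
    then have "a - g = (\<Sum>b\<in>B. frac (c b) *\<^sub>R b)"
      by (simp add: g_def frac_def algebra_simps sum_subtractf)
    also have "norm \<dots> \<le> R"
      unfolding R_def by (intro sum_norm_le) (simp add: mult_left_le_one_le frac_lt_1 less_imp_le)
    finally have "norm (a - g) \<le> R" .
    moreover have g: "g \<in> G"
      unfolding g_def using B by (intro add_subgroup_sum[OF G] add_subgroup_of_int_scaleR[OF G]) auto
    ultimately have "a - g \<in> A \<inter> cball 0 R" using add_subgroup_diff[OF A a] \<open>G \<subseteq> A\<close> by auto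
    moreover have "torus_point G a = torus_point G (a - g)" using g by (simp add: torus_point_eq_iff[OF G])
    ultimately show "torus_point G a \<in> torus_point G ` (A \<inter> cball 0 R)" by blast
  qed
  then show ?thesis using discrete finite_subset by blast
qed

section \<open>Area scaling under complex multiplication\<close>

text \<open>Moves area to \<open>real^2\<close>, where multiplication by a complex number can be
  treated as a real matrix with a determinant.\<close>

lemma lborel_complex:
  "(lborel :: complex measure) = distr lborel borel (\<lambda>v::real^2. Complex (v $ 1) (v $ 2))"
proof (rule lborel_eqI)
  have [measurable]: "(\<lambda>v::real^2. Complex (v $ 1) (v $ 2)) \<in> borel_measurable borel"
    unfolding complex_eq by (intro borel_measurable_continuous_onI continuous_intros)
  fix l u :: complex assume "\<And>b. b \<in> Basis \<Longrightarrow> l \<bullet> b \<le> u \<bullet> b"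
  from this[of 1] this[of \<i>] have le: "Re l \<le> Re u" "Im l \<le> Im u" by (auto simp: Basis_complex_def)
  have "(\<lambda>v::real^2. Complex (v $ 1) (v $ 2)) -` box l u =
      box (vector [Re l, Im l]) (vector [Re u, Im u])"
    by (auto simp: in_box_complex_iff mem_box_cart forall_2)
  moreover have "emeasure lborel (box (vector [Re l, Im l] :: real^2) (vector [Re u, Im u])) =
      ennreal ((Re u - Re l) * (Im u - Im l))"
    using le by (subst emeasure_lborel_box_eq)
      (auto simp: Basis_vec_def UNIV_2 inner_axis axis_eq_axis)
  ultimately show "emeasure (distr lborel borel (\<lambda>v::real^2. Complex (v $ 1) (v $ 2))) (box l u) =
      (\<Prod>b\<in>Basis. (u - l) \<bullet> b)"
    by (simp add: emeasure_distr Basis_complex_def)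
qed simp

text \<open>Multiplication by c is a real linear map of determinant \<open>(cmod c)\<^sup>2\<close>.
  Boundedness of X keeps all measures finite. The preimage is used because dividing a lattice by c
  takes the preimage of its fundamental domain.\<close>

lemma emeasure_lborel_complex_mult:
  assumes X [measurable]: "X \<in> sets borel" and "bounded X" and "c \<noteq> 0"
  shows "emeasure lborel X = ennreal ((cmod c)\<^sup>2) * emeasure lborel ((*) c -` X)"
proof -
  define \<psi> :: "real^2 \<Rightarrow> complex" where "\<psi> v = Complex (v $ 1) (v $ 2)" for v
  define \<phi> :: "complex \<Rightarrow> real^2" where "\<phi> z = vector [Re z, Im z]" for z
  define f where "f v = \<phi> (c * \<psi> v)" for v
  have inv [simp]: "\<psi> (\<phi> z) = z" "\<phi> (\<psi> v) = v" for z v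
    by (auto simp: \<psi>_def \<phi>_def vec_eq_iff forall_2)
  have cont: "continuous_on UNIV \<psi>"
    unfolding complex_eq \<psi>_def by (intro continuous_intros)
  have [measurable]: "\<psi> \<in> borel_measurable borel"
    using cont by (rule borel_measurable_continuous_onI)
  have [measurable]: "(*) c -` X \<in> sets borel"
    using measurable_sets[OF _ X, of "(*) c" borel] by simp
  have lborel: "lborel = distr lborel borel \<psi>" unfolding \<psi>_def[abs_def] by (rule lborel_complex)
  have eq: "emeasure lborel Y = emeasure lborel (\<psi> -` Y)" if [measurable]: "Y \<in> sets borel" for Y
    by (subst lborel) (simp add: emeasure_distr)
  have lin: "linear f"
    by (auto simp: linear_iff f_def \<phi>_def \<psi>_def vec_eq_iff forall_2 algebra_simps)
  have det: "det (matrix f) = (cmod c)\<^sup>2"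
    unfolding cmod_power2 by (simp add: det_2 matrix_def f_def \<phi>_def \<psi>_def axis_def power2_eq_square)
  have meas: "\<psi> -` Y \<in> lmeasurable" if "Y \<in> sets borel" "bounded Y" for Y
  proof (rule bounded_set_imp_lmeasurable)
    have "\<psi> -` Y \<subseteq> \<phi> ` Y" by (metis image_eqI inv(2) subsetI vimageE)
    moreover have "bounded (\<phi> ` Y)"
      using that(2) by (intro bounded_linear_image)
        (auto simp: linear_conv_bounded_linear[symmetric] linear_iff \<phi>_def vec_eq_iff forall_2)
    ultimately show "bounded (\<psi> -` Y)" by (rule bounded_subset[rotated])
    show "\<psi> -` Y \<in> sets lebesgue" using that measurable_sets[of \<psi> borel borel Y] by auto
  qed
  have bounded: "bounded ((*) c -` X)"
  proof -
    have "(*) c -` X = (*) (inverse c) ` X"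
      using \<open>c \<noteq> 0\<close> by (auto simp: image_iff field_simps)
    then show ?thesis using \<open>bounded X\<close> bounded_linear_image bounded_linear_mult_right by metis
  qed
  have "\<psi> -` X = f ` (\<psi> -` ((*) c -` X))"
  proof (intro set_eqI iffI)
    fix v assume "v \<in> \<psi> -` X"
    then show "v \<in> f ` (\<psi> -` ((*) c -` X))"
      using \<open>c \<noteq> 0\<close> by (intro image_eqI[of _ _ "\<phi> (\<psi> v / c)"]) (auto simp: f_def)
  qed (auto simp: f_def)
  then have "measure lebesgue (\<psi> -` X) = (cmod c)\<^sup>2 * measure lebesgue (\<psi> -` ((*) c -` X))"
    using measure_linear_image[OF lin meas[OF _ bounded]] by (simp add: det)
  moreover have vol: "emeasure lborel Y = ennreal (measure lebesgue (\<psi> -` Y))"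
    if "Y \<in> sets borel" "bounded Y" for Y
  proof -
    have "\<psi> -` Y \<in> sets lborel" using that measurable_sets[of \<psi> borel borel Y] by simp
    then have "emeasure lborel (\<psi> -` Y) = emeasure lebesgue (\<psi> -` Y)" by simp
    also have "\<dots> = ennreal (measure lebesgue (\<psi> -` Y))" by (rule emeasure_eq_measure2[OF meas[OF that]])
    finally show ?thesis using eq[OF that(1)] by simp
  qed
  ultimately have "emeasure lborel X = ennreal ((cmod c)\<^sup>2 * measure lebesgue (\<psi> -` ((*) c -` X)))"
    using X \<open>bounded X\<close> by metis
  also have "\<dots> = ennreal ((cmod c)\<^sup>2) * ennreal (measure lebesgue (\<psi> -` ((*) c -` X)))"
    by (rule ennreal_mult) auto
  also have "ennreal (measure lebesgue (\<psi> -` ((*) c -` X))) = emeasure lborel ((*) c -` X)"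
    by (rule vol[symmetric]) (use bounded in auto)
  finally show ?thesis .
qed

section \<open>Degrees of elliptic curves\<close>

text \<open>Both images are in bijection with the set of pairs \<open>(f x, g x)\<close>. This will
  count points on a curve by cosets of parameters.\<close>

lemma card_image_eq_if_same_fibres:
  assumes "\<And>x y. x \<in> A \<Longrightarrow> y \<in> A \<Longrightarrow> f x = f y \<longleftrightarrow> g x = g y"
  shows "card (f ` A) = card (g ` A)" "finite (f ` A) \<longleftrightarrow> finite (g ` A)"
proof -
  let ?P = "(\<lambda>x. (f x, g x)) ` A"
  have "bij_betw fst ?P (f ` A)" "bij_betw snd ?P (g ` A)"
    using assms by (auto simp: bij_betw_def inj_on_def image_image)
  then show "card (f ` A) = card (g ` A)" "finite (f ` A) \<longleftrightarrow> finite (g ` A)"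
    by (metis bij_betw_same_card, metis bij_betw_finite)
qed

lemma lattice_neq_UNIV:
  fixes L :: "'a::euclidean_space set"
  assumes "is_lattice L"
  shows "L \<noteq> UNIV"
  using countable_lattice[OF assms] uncountable_ball[of 1 "0::'a"] countable_subset[of "ball 0 1" UNIV]
  by auto

lemma add_subgroup_power_lattice: "add_subgroup \<Lambda> \<Longrightarrow> add_subgroup (power_lattice \<Lambda>)"
  by (auto simp: add_subgroup_def power_lattice_def)

definition coordinate_periods :: "complex set \<Rightarrow> complex^'g \<Rightarrow> 'g \<Rightarrow> complex set" where
  "coordinate_periods \<Lambda> w i = {s. s * w $ i \<in> \<Lambda>}"

definition periods :: "complex set \<Rightarrow> complex^'g \<Rightarrow> complex set" where
  "periods \<Lambda> w = {s. s *s w \<in> power_lattice \<Lambda>}"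

text \<open>
  Parametrizing the curve by \<open>s \<mapsto> s *s w\<close>, it is \<open>\<complex>/periods \<Lambda> w\<close>, and the kernel of its projection to
  the i-th factor is \<open>coordinate_periods \<Lambda> w i/periods \<Lambda> w\<close>; the degree is the order of the kernel.
\<close>

definition projection_degree :: "complex set \<Rightarrow> complex^'g \<Rightarrow> 'g \<Rightarrow> nat" where
  "projection_degree \<Lambda> w i = card (torus_point (periods \<Lambda> w) ` coordinate_periods \<Lambda> w i)"

lemma add_subgroup_periods:
  assumes "add_subgroup \<Lambda>"
  shows "add_subgroup (periods \<Lambda> w)" "add_subgroup (coordinate_periods \<Lambda> w i)"
  using assms by (auto simp: add_subgroup_def periods_def coordinate_periods_def power_lattice_def left_diff_distrib)

lemma periods_subset: "periods \<Lambda> w \<subseteq> coordinate_periods \<Lambda> w i"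
  by (auto simp: periods_def coordinate_periods_def power_lattice_def)

text \<open>As the i-th coordinate of w is nonzero, \<open>coordinate_periods \<Lambda> w i\<close>
  is a rescaled copy of \<Lambda>, hence discrete, and it contains the periods, which span the
  plane.\<close>

lemma finite_projection_fibre:
  fixes w :: "complex^'g"
  assumes \<Lambda>: "is_lattice \<Lambda>" and "span (periods \<Lambda> w) = UNIV" and w: "w $ i \<noteq> 0"
  shows "finite (torus_point (periods \<Lambda> w) ` coordinate_periods \<Lambda> w i)"
proof (rule finite_index)
  fix r
  have "coordinate_periods \<Lambda> w i \<inter> cball 0 r \<subseteq> (\<lambda>z. z / w $ i) ` (\<Lambda> \<inter> cball 0 (r * cmod (w $ i)))"
  proof
    fix s assume "s \<in> coordinate_periods \<Lambda> w i \<inter> cball 0 r"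
    then show "s \<in> (\<lambda>z. z / w $ i) ` (\<Lambda> \<inter> cball 0 (r * cmod (w $ i)))"
      using w by (intro image_eqI[of _ _ "s * w $ i"])
        (auto simp: coordinate_periods_def norm_mult mult_right_mono)
  qed
  then show "finite (coordinate_periods \<Lambda> w i \<inter> cball 0 r)"
    using finite_lattice_Int_cball[OF \<Lambda>] finite_surj by blast
qed (use assms in \<open>auto intro!: lattice_add_subgroup periods_subset add_subgroup_periods\<close>)

lemma projection_degree_pos:
  fixes w :: "complex^'g"
  assumes "is_lattice \<Lambda>" "span (periods \<Lambda> w) = UNIV" "w $ i \<noteq> 0"
  shows "projection_degree \<Lambda> w i > 0"
proof -
  have "coordinate_periods \<Lambda> w i \<noteq> {}"
    using add_subgroup_zero add_subgroup_periods lattice_add_subgroup assms(1) by blast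
  then show ?thesis
    using finite_projection_fibre[OF assms] by (simp add: projection_degree_def card_gt_0_iff)
qed

text \<open>A fundamental domain of \<open>periods \<Lambda> w\<close> has area d V / |w_k|^2, where
  V is the area for \<Lambda> and d the degree of the k-th projection. Equating this for k = i and k
  = j gives the relation.\<close>

lemma projection_degree_ratio:
  fixes w :: "complex^'g"
  assumes \<Lambda>: "is_lattice \<Lambda>" and span: "span (periods \<Lambda> w) = UNIV" and w: "w $ i \<noteq> 0" "w $ j \<noteq> 0"
  shows "real (projection_degree \<Lambda> w i) * (cmod (w $ j))\<^sup>2 = real (projection_degree \<Lambda> w j) * (cmod (w $ i))\<^sup>2"
proof -
  obtain P where P: "fundamental_domain \<Lambda> P" "bounded P"
    by (rule lattice_fundamental_domain[OF \<Lambda>])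
  have borel: "P \<in> sets borel" using P by (simp add: fundamental_domain_def)
  note sub = lattice_add_subgroup[OF \<Lambda>]
  define V where "V = measure lborel P"
  have V: "emeasure lborel P = ennreal V" "V > 0"
  proof -
    show "emeasure lborel P = ennreal V"
      using emeasure_bounded_finite[OF P(2)] by (simp add: V_def emeasure_eq_ennreal_measure)
    then show "V > 0"
      using emeasure_fundamental_domain_pos[OF countable_lattice[OF \<Lambda>] P(1)] by (simp add: ennreal_less_zero_iff)
  qed
  \<comment> \<open>The preimage E of P under multiplication by \<open>w $ k\<close> is a domain for
    the coordinate periods; passing to the periods multiplies its area by the index.\<close>
  have dom: "\<exists>D. fundamental_domain (periods \<Lambda> w) D \<and>
      ennreal ((cmod (w $ k))\<^sup>2) * emeasure lborel D = ennreal (real (projection_degree \<Lambda> w k) * V)"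
    if k: "w $ k \<noteq> 0" for k
  proof -
    define E where "E = (*) (w $ k) -` P"
    have "fundamental_domain (coordinate_periods \<Lambda> w k) E"
      unfolding fundamental_domain_def
    proof (intro conjI allI)
      show "E \<in> sets borel" using measurable_sets[OF _ borel, of "(*) (w $ k)" borel] by (simp add: E_def)
      fix z
      obtain g where g: "g \<in> \<Lambda>" "w $ k * z - g \<in> P" and
        uniq: "\<And>h. h \<in> \<Lambda> \<Longrightarrow> w $ k * z - h \<in> P \<Longrightarrow> h = g"
        using P(1) unfolding fundamental_domain_def by metis
      show "\<exists>!s. s \<in> coordinate_periods \<Lambda> w k \<and> z - s \<in> E"
      proof (rule ex1I)
        show "g / w $ k \<in> coordinate_periods \<Lambda> w k \<and> z - g / w $ k \<in> E"
          using g k by (auto simp: coordinate_periods_def E_def right_diff_distrib)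
        fix s assume "s \<in> coordinate_periods \<Lambda> w k \<and> z - s \<in> E"
        then have "s * w $ k = g"
          by (intro uniq) (auto simp: coordinate_periods_def E_def right_diff_distrib mult.commute)
        then show "s = g / w $ k" using k by (auto simp: field_simps)
      qed
    qed
    then obtain D where D: "fundamental_domain (periods \<Lambda> w) D"
      "emeasure lborel D = of_nat (projection_degree \<Lambda> w k) * emeasure lborel E"
      using fundamental_domain_finite_index[OF add_subgroup_periods(2,1)[OF sub] periods_subset _
          finite_projection_fibre[OF \<Lambda> span k]] by (auto simp: projection_degree_def)
    have "ennreal ((cmod (w $ k))\<^sup>2) * emeasure lborel E = ennreal V"
      using emeasure_lborel_complex_mult[OF borel P(2) k] by (simp add: E_def V)
    then have "ennreal ((cmod (w $ k))\<^sup>2) * emeasure lborel D = of_nat (projection_degree \<Lambda> w k) * ennreal V"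
      using D(2) by (metis mult.left_commute)
    then show ?thesis using D(1) V(2) by (auto simp: ennreal_mult ennreal_of_nat_eq_real_of_nat)
  qed
  obtain D where D: "fundamental_domain (periods \<Lambda> w) D"
      "ennreal ((cmod (w $ i))\<^sup>2) * emeasure lborel D = ennreal (real (projection_degree \<Lambda> w i) * V)"
    using dom[OF w(1)] by blast
  obtain D' where D': "fundamental_domain (periods \<Lambda> w) D'"
      "ennreal ((cmod (w $ j))\<^sup>2) * emeasure lborel D' = ennreal (real (projection_degree \<Lambda> w j) * V)"
    using dom[OF w(2)] by blast
  \<comment> \<open>Reading off the i-th coordinate embeds the periods into \<Lambda>.\<close>
  have "countable (periods \<Lambda> w)"
  proof -
    have "inj_on (\<lambda>s. s * w $ i) (periods \<Lambda> w)" "(\<lambda>s. s * w $ i) ` periods \<Lambda> w \<subseteq> \<Lambda>"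
      using w by (auto simp: inj_on_def periods_def power_lattice_def)
    then show ?thesis using countable_lattice[OF \<Lambda>] by (metis countable_image_inj_on countable_subset)
  qed
  then have "emeasure lborel D = emeasure lborel D'"
    using D(1) D'(1) add_subgroup_periods(1)[OF sub] by (intro emeasure_fundamental_domain_eq)
  then have "ennreal ((cmod (w $ j))\<^sup>2) * ennreal (real (projection_degree \<Lambda> w i) * V) =
      ennreal ((cmod (w $ i))\<^sup>2) * ennreal (real (projection_degree \<Lambda> w j) * V)"
    using D(2) D'(2) by (metis mult.left_commute)
  then have "(cmod (w $ j))\<^sup>2 * (real (projection_degree \<Lambda> w i) * V) =
      (cmod (w $ i))\<^sup>2 * (real (projection_degree \<Lambda> w j) * V)"
    using V(2) by (simp add: ennreal_mult[symmetric] del: ennreal_mult'')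
  then show ?thesis using V(2) by (simp add: mult.commute)
qed

text \<open>By Lagrange's theorem the degree times u / w_i is a period, since u / w_i is a
  coordinate period. Its multiple of w has j-th coordinate in \<Lambda>.\<close>

lemma projection_degree_endomorphism:
  fixes w :: "complex^'g"
  assumes \<Lambda>: "is_lattice \<Lambda>" and span: "span (periods \<Lambda> w) = UNIV" and w: "w $ i \<noteq> 0" and u: "u \<in> \<Lambda>"
  shows "of_nat (projection_degree \<Lambda> w i) * (w $ j / w $ i) * u \<in> \<Lambda>"
proof -
  note sub = lattice_add_subgroup[OF \<Lambda>]
  have "u / w $ i \<in> coordinate_periods \<Lambda> w i" using u w by (simp add: coordinate_periods_def)
  then have "real (projection_degree \<Lambda> w i) *\<^sub>R (u / w $ i) \<in> periods \<Lambda> w"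
    unfolding projection_degree_def
    by (intro index_scaleR_mem[OF add_subgroup_periods(2,1)[OF sub] periods_subset
          finite_projection_fibre[OF \<Lambda> span w]])
  then have "(real (projection_degree \<Lambda> w i) *\<^sub>R (u / w $ i)) * w $ j \<in> \<Lambda>"
    by (auto simp: periods_def power_lattice_def)
  then show ?thesis by (simp add: scaleR_conv_of_real ac_simps)
qed

section \<open>Intersection numbers with the product divisor\<close>

lemma divisor_support_translate_product:
  fixes x :: "complex^'g" and m :: "'g \<Rightarrow> nat"
  assumes "\<And>i. m i > 0"
  shows "divisor_support L (translate_divisor x (product_divisor \<Lambda> m)) =
    {torus_point L v |v. \<exists>i. v $ i - x $ i \<in> \<Lambda>}"
proof -
  have "translate_divisor x (product_divisor \<Lambda> m) v v = 0 \<longleftrightarrow> (\<exists>i. v $ i - x $ i \<in> \<Lambda>)" for v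
    using assms by (auto simp: translate_divisor_def product_divisor_def origin_divisor_def)
  then show ?thesis by (simp add: divisor_support_def)
qed

text \<open>Along the line, each factor whose coordinate meets the divisor is a power of s times
  \<open>w $ i\<close>, and the others are 1. The local equation is thus a nonzero constant times a
  power of s.\<close>

lemma local_multiplicity_translate_product:
  fixes v x w :: "complex^'g" and m :: "'g \<Rightarrow> nat"
  assumes \<Lambda>: "add_subgroup \<Lambda>" and w: "\<And>i. v $ i - x $ i \<in> \<Lambda> \<Longrightarrow> w $ i \<noteq> 0"
  shows "local_multiplicity (translate_divisor x (product_divisor \<Lambda> m)) w (torus_point (power_lattice \<Lambda>) v) =
    (\<Sum>i | v $ i - x $ i \<in> \<Lambda>. int (m i))"
proof -
  define I where "I = {i. v $ i - x $ i \<in> \<Lambda>}"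
  \<comment> \<open>The definition picks an arbitrary representative of the point; it differs from v
    by a lattice vector, so the same factors vanish at it.\<close>
  define v' where "v' = (SOME v'. v' \<in> torus_point (power_lattice \<Lambda>) v)"
  have "v \<in> torus_point (power_lattice \<Lambda>) v"
    using add_subgroup_zero[OF add_subgroup_power_lattice[OF \<Lambda>]] by (auto simp: torus_point_def image_iff)
  then have "v' \<in> torus_point (power_lattice \<Lambda>) v" unfolding v'_def by (rule someI)
  then have diff: "v' $ i - v $ i \<in> \<Lambda>" for i by (auto simp: torus_point_def power_lattice_def)
  have I: "v' $ i - x $ i \<in> \<Lambda> \<longleftrightarrow> i \<in> I" for i
    using add_subgroup_add[OF \<Lambda> diff[of i], of "v $ i - x $ i"]
      add_subgroup_diff[OF \<Lambda> _ diff[of i], of "v' $ i - x $ i"] by (auto simp: I_def)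
  have "translate_divisor x (product_divisor \<Lambda> m) v' (v' + s *s w) =
      (\<Prod>i\<in>I. w $ i ^ m i) * s ^ (\<Sum>i\<in>I. m i)" for s
  proof -
    have "translate_divisor x (product_divisor \<Lambda> m) v' (v' + s *s w) =
        (\<Prod>i\<in>UNIV. if i \<in> I then (s * w $ i) ^ m i else 1)"
      unfolding translate_divisor_def product_divisor_def
      by (rule prod.cong) (auto simp: origin_divisor_def I)
    also have "\<dots> = (\<Prod>i\<in>I. (s * w $ i) ^ m i)" by (simp add: prod.If_cases)
    finally show ?thesis by (simp add: power_mult_distrib prod.distrib power_sum)
  qed
  moreover have "zorder (\<lambda>s. (\<Prod>i\<in>I. w $ i ^ m i) * s ^ (\<Sum>i\<in>I. m i)) 0 = int (\<Sum>i\<in>I. m i)"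
    using w by (intro zorder_eqI[where S = UNIV and g = "\<lambda>_. \<Prod>i\<in>I. w $ i ^ m i"]) (auto simp: I_def simp del: of_nat_sum)
  ultimately show ?thesis by (simp add: local_multiplicity_def v'_def[symmetric] Let_def I_def)
qed

text \<open>The direction w of the curve is only seen through the coordinates that vanish on it, so the
  sum of the local multiplicities may be computed with any direction w' of the same curve.\<close>

lemma sum_local_multiplicity:
  fixes w w' :: "complex^'g" and m :: "'g \<Rightarrow> nat"
  assumes \<Lambda>: "is_lattice \<Lambda>" and m: "\<And>i. m i > 0" and span: "span (periods \<Lambda> w) = UNIV"
    and F: "F = torus_point (power_lattice \<Lambda>) ` {s *s w |s. True}"
    and w': "\<And>i. w' $ i = 0 \<longleftrightarrow> w $ i = 0"
    and nsub: "\<not> F \<subseteq> divisor_support (power_lattice \<Lambda>) (translate_divisor x (product_divisor \<Lambda> m))"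
  shows "(\<Sum>P\<in>F \<inter> divisor_support (power_lattice \<Lambda>) (translate_divisor x (product_divisor \<Lambda> m)).
      local_multiplicity (translate_divisor x (product_divisor \<Lambda> m)) w' P) =
    (\<Sum>i | w $ i \<noteq> 0. int (m i) * int (projection_degree \<Lambda> w i))"
proof -
  define L where "L = (power_lattice \<Lambda> :: (complex^'g) set)"
  define D where "D = translate_divisor x (product_divisor \<Lambda> m)"
  define W where "W = {s *s w |s. True}"
  \<comment> \<open>\<open>H i\<close> consists of the points of F on the i-th summand of the
    translated divisor.\<close>
  define H where "H i = {torus_point L v |v. v \<in> W \<and> v $ i - x $ i \<in> \<Lambda>}" for i
  note sub = lattice_add_subgroup[OF \<Lambda>]
  have L: "add_subgroup L" unfolding L_def by (rule add_subgroup_power_lattice[OF sub])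
  have same: "v $ i - x $ i \<in> \<Lambda> \<longleftrightarrow> u $ i - x $ i \<in> \<Lambda>" if "torus_point L v = torus_point L u" for u v i
  proof -
    have "v - u \<in> L" using that by (simp add: torus_point_eq_iff[OF L])
    then have "v $ i - u $ i \<in> \<Lambda>" by (auto simp: L_def power_lattice_def)
    then show ?thesis
      using add_subgroup_add[OF sub, of "v $ i - u $ i" "u $ i - x $ i"]
        add_subgroup_diff[OF sub, of "v $ i - x $ i" "v $ i - u $ i"] by auto
  qed
  have supp: "divisor_support L D = {torus_point L v |v. \<exists>i. v $ i - x $ i \<in> \<Lambda>}"
    unfolding D_def using m by (rule divisor_support_translate_product)
  have HF: "torus_point L v \<in> H i \<longleftrightarrow> v $ i - x $ i \<in> \<Lambda>" if "v \<in> W" for v i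
    using that same unfolding H_def by blast
  have FS: "F \<inter> divisor_support L D = (\<Union>i. H i)"
    unfolding supp F L_def[symmetric] W_def[symmetric] H_def using same by blast
  \<comment> \<open>If the i-th coordinate is constant along the line, a single point on the i-th
    summand would put all of F into the divisor.\<close>
  have H0: "H i = {}" if "w $ i = 0" for i
  proof (rule ccontr)
    assume "H i \<noteq> {}"
    then have "- x $ i \<in> \<Lambda>" using that by (auto simp: H_def W_def)
    then have "(s *s w) $ i - x $ i \<in> \<Lambda>" for s using that by simp
    then have "F \<subseteq> divisor_support L D" unfolding supp F L_def[symmetric] by blast
    then show False using nsub by (simp add: L_def D_def)
  qed
  have H: "finite (H i) \<and> card (H i) = projection_degree \<Lambda> w i" if i: "w $ i \<noteq> 0" for i
  proof -
    \<comment> \<open>The parameter x_i / w_i solves the equation of the i-th summand; all solutions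
      differ from it by coordinate periods, so points of \<open>H i\<close> correspond to cosets of
      periods.\<close>
    define f where "f a = torus_point L ((x $ i / w $ i + a) *s w)" for a
    have "H i = f ` coordinate_periods \<Lambda> w i"
    proof (intro set_eqI iffI)
      fix P assume "P \<in> H i"
      then obtain s where "P = torus_point L (s *s w)" "s * w $ i - x $ i \<in> \<Lambda>" by (auto simp: H_def W_def)
      then show "P \<in> f ` coordinate_periods \<Lambda> w i"
        using i by (intro image_eqI[of _ _ "s - x $ i / w $ i"])
          (auto simp: f_def coordinate_periods_def left_diff_distrib)
    next
      fix P assume "P \<in> f ` coordinate_periods \<Lambda> w i"
      then obtain a where a: "P = f a" "a * w $ i \<in> \<Lambda>" by (auto simp: coordinate_periods_def)
      have "((x $ i / w $ i + a) *s w) $ i - x $ i = a * w $ i" using i by (simp add: distrib_right)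
      then have "((x $ i / w $ i + a) *s w) $ i - x $ i \<in> \<Lambda>" using a(2) by simp
      then show "P \<in> H i" unfolding H_def a(1) f_def W_def by blast
    qed
    moreover have "f a = f b \<longleftrightarrow> torus_point (periods \<Lambda> w) a = torus_point (periods \<Lambda> w) b" for a b
    proof -
      have "(x $ i / w $ i + a) *s w - (x $ i / w $ i + b) *s w = (a - b) *s w"
        by (simp add: vec_eq_iff algebra_simps)
      then have "f a = f b \<longleftrightarrow> a - b \<in> periods \<Lambda> w"
        unfolding f_def torus_point_eq_iff[OF L] by (simp add: periods_def L_def)
      then show ?thesis by (simp only: torus_point_eq_iff[OF add_subgroup_periods(1)[OF sub]])
    qed
    ultimately show ?thesis
      using card_image_eq_if_same_fibres[of "coordinate_periods \<Lambda> w i" f "torus_point (periods \<Lambda> w)"]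
        finite_projection_fibre[OF \<Lambda> span i] by (simp add: projection_degree_def)
  qed
  then have fin: "finite (H i)" for i using H0 by (cases "w $ i = 0") auto
  have mult: "local_multiplicity D w' P = (\<Sum>i\<in>UNIV. if P \<in> H i then int (m i) else 0)" if P: "P \<in> (\<Union>i. H i)" for P
  proof -
    obtain i where "P \<in> H i" using P by blast
    then obtain v where v: "v \<in> W" "P = torus_point L v" unfolding H_def by blast
    have "w' $ i \<noteq> 0" if "v $ i - x $ i \<in> \<Lambda>" for i
      using H0[of i] HF[OF v(1), of i] that w'[of i] by auto
    then have "local_multiplicity D w' P = (\<Sum>i | v $ i - x $ i \<in> \<Lambda>. int (m i))"
      unfolding v(2) D_def L_def by (intro local_multiplicity_translate_product[OF sub])
    also have "\<dots> = (\<Sum>i\<in>UNIV. if P \<in> H i then int (m i) else 0)"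
      by (simp add: v(2) HF[OF v(1)] sum.If_cases)
    finally show ?thesis .
  qed
  have "(\<Sum>P\<in>F \<inter> divisor_support L D. local_multiplicity D w' P) =
      (\<Sum>P\<in>(\<Union>i. H i). \<Sum>i\<in>UNIV. if P \<in> H i then int (m i) else 0)"
    unfolding FS using mult by (intro sum.cong) auto
  \<comment> \<open>Summing over the points first counts each \<open>H i\<close> with weight
    \<open>m i\<close>, even where several summands meet in one point.\<close>
  also have "\<dots> = (\<Sum>i\<in>UNIV. \<Sum>P\<in>(\<Union>i. H i). if P \<in> H i then int (m i) else 0)"
    by (rule sum.swap)
  also have "\<dots> = (\<Sum>i\<in>UNIV. int (m i) * int (card (H i)))"
  proof (rule sum.cong[OF refl])
    fix i
    have "(\<Union>i. H i) \<inter> {P. P \<in> H i} = H i" by blast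
    then show "(\<Sum>P\<in>(\<Union>i. H i). if P \<in> H i then int (m i) else 0) = int (m i) * int (card (H i))"
      using fin by (subst sum.If_cases) auto
  qed
  also have "\<dots> = (\<Sum>i | w $ i \<noteq> 0. int (m i) * int (card (H i)))"
    using H0 by (intro sum.mono_neutral_right) auto
  also have "\<dots> = (\<Sum>i | w $ i \<noteq> 0. int (m i) * int (projection_degree \<Lambda> w i))"
    using H by (intro sum.cong) auto
  finally show ?thesis by (simp add: L_def D_def)
qed

text \<open>Along the first line the i-th coordinate stays in \<Lambda> modulo \<Lambda>, whereas a
  nonzero coordinate of w' would take every complex value, forcing \<Lambda> to be the whole
  plane.\<close>

lemma line_image_zero_coordinate:
  fixes w w' :: "complex^'g"
  assumes \<Lambda>: "is_lattice \<Lambda>"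
    and eq: "torus_point (power_lattice \<Lambda>) ` {s *s w |s. True} = torus_point (power_lattice \<Lambda>) ` {s *s w' |s. True}"
    and w: "w $ i = 0"
  shows "w' $ i = 0"
proof (rule ccontr)
  assume nz: "w' $ i \<noteq> 0"
  have "z \<in> \<Lambda>" for z
  proof -
    have "torus_point (power_lattice \<Lambda>) ((z / w' $ i) *s w') \<in> torus_point (power_lattice \<Lambda>) ` {s *s w |s. True}"
      unfolding eq by blast
    then obtain t where "torus_point (power_lattice \<Lambda>) ((z / w' $ i) *s w') = torus_point (power_lattice \<Lambda>) (t *s w)"
      by blast
    then have "(z / w' $ i) *s w' - t *s w \<in> power_lattice \<Lambda>"
      by (simp add: torus_point_eq_iff[OF add_subgroup_power_lattice[OF lattice_add_subgroup[OF \<Lambda>]]])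
    then have "((z / w' $ i) *s w' - t *s w) $ i \<in> \<Lambda>" unfolding power_lattice_def by blast
    then show ?thesis using w nz by simp
  qed
  then show False using lattice_neq_UNIV[OF \<Lambda>] by blast
qed

text \<open>Shows that the definite description in \<open>intersection_number\<close> is well
  defined: an admissible translate exists, and every admissible direction and translate give the
  same sum.\<close>

lemma intersection_number_line:
  fixes w :: "complex^'g" and m :: "'g \<Rightarrow> nat"
  assumes \<Lambda>: "is_lattice \<Lambda>" and m: "\<And>i. m i > 0" and w: "w \<noteq> 0" and span: "span (periods \<Lambda> w) = UNIV"
    and F: "F = torus_point (power_lattice \<Lambda>) ` {s *s w |s. True}"
  shows "intersection_number (power_lattice \<Lambda>) F (product_divisor \<Lambda> m) =
    (\<Sum>i | w $ i \<noteq> 0. int (m i) * int (projection_degree \<Lambda> w i))"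
  unfolding intersection_number_def
proof (rule the_equality)
  \<comment> \<open>Shifting every coordinate by a c outside \<Lambda> moves the divisor off the
    origin, which lies on F.\<close>
  obtain c where c: "c \<notin> \<Lambda>" using lattice_neq_UNIV[OF \<Lambda>] by blast
  define x :: "complex^'g" where "x = (\<chi> i. c)"
  note sub = lattice_add_subgroup[OF \<Lambda>]
  have "torus_point (power_lattice \<Lambda>) 0 \<notin> divisor_support (power_lattice \<Lambda>) (translate_divisor x (product_divisor \<Lambda> m))"
  proof
    assume "torus_point (power_lattice \<Lambda>) 0 \<in> divisor_support (power_lattice \<Lambda>) (translate_divisor x (product_divisor \<Lambda> m))"
    then obtain v :: "complex^'g" and i where "v $ i - c \<in> \<Lambda>" "torus_point (power_lattice \<Lambda>) v = torus_point (power_lattice \<Lambda>) 0"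
      using m by (auto simp: divisor_support_translate_product x_def)
    moreover from this have "v \<in> power_lattice \<Lambda>"
      by (simp add: torus_point_eq_iff[OF add_subgroup_power_lattice[OF sub]])
    then have "v $ i \<in> \<Lambda>" by (simp add: power_lattice_def)
    ultimately show False using add_subgroup_diff[OF sub, of "v $ i" "v $ i - c"] c by simp
  qed
  moreover have "torus_point (power_lattice \<Lambda>) 0 \<in> F" unfolding F by (force intro: exI[of _ 0])
  ultimately have nsub: "\<not> F \<subseteq> divisor_support (power_lattice \<Lambda>) (translate_divisor x (product_divisor \<Lambda> m))"
    by blast
  show "\<exists>w' x. w' \<noteq> 0 \<and> F = torus_point (power_lattice \<Lambda>) ` {s *s w' |s. True} \<and>
      \<not> F \<subseteq> divisor_support (power_lattice \<Lambda>) (translate_divisor x (product_divisor \<Lambda> m)) \<and>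
      (\<Sum>i | w $ i \<noteq> 0. int (m i) * int (projection_degree \<Lambda> w i)) =
      (\<Sum>P\<in>F \<inter> divisor_support (power_lattice \<Lambda>) (translate_divisor x (product_divisor \<Lambda> m)).
        local_multiplicity (translate_divisor x (product_divisor \<Lambda> m)) w' P)"
    using sum_local_multiplicity[OF \<Lambda> m span F _ nsub, of w] w F nsub by (intro exI[of _ w] exI[of _ x]) auto
next
  fix n
  assume "\<exists>w' x. w' \<noteq> 0 \<and> F = torus_point (power_lattice \<Lambda>) ` {s *s w' |s. True} \<and>
      \<not> F \<subseteq> divisor_support (power_lattice \<Lambda>) (translate_divisor x (product_divisor \<Lambda> m)) \<and>
      n = (\<Sum>P\<in>F \<inter> divisor_support (power_lattice \<Lambda>) (translate_divisor x (product_divisor \<Lambda> m)).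
        local_multiplicity (translate_divisor x (product_divisor \<Lambda> m)) w' P)"
  then obtain w' x where F': "F = torus_point (power_lattice \<Lambda>) ` {s *s w' |s. True}"
    and nsub: "\<not> F \<subseteq> divisor_support (power_lattice \<Lambda>) (translate_divisor x (product_divisor \<Lambda> m))"
    and n: "n = (\<Sum>P\<in>F \<inter> divisor_support (power_lattice \<Lambda>) (translate_divisor x (product_divisor \<Lambda> m)).
        local_multiplicity (translate_divisor x (product_divisor \<Lambda> m)) w' P)" by blast
  have "w' $ i = 0 \<longleftrightarrow> w $ i = 0" for i
    using line_image_zero_coordinate[OF \<Lambda>, of w w' i] line_image_zero_coordinate[OF \<Lambda>, of w' w i] F F' by auto
  then show "n = (\<Sum>i | w $ i \<noteq> 0. int (m i) * int (projection_degree \<Lambda> w i))"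
    unfolding n by (intro sum_local_multiplicity[OF \<Lambda> m span F _ nsub])
qed

text \<open>The map s to \<open>s *s w\<close> is an injective real linear map onto W that carries
  the periods onto the lattice points of W, so the spanning condition pulls back to the parameter
  plane.\<close>

lemma elliptic_curve_line:
  fixes F :: "(complex^'g) set set"
  assumes "F \<in> elliptic_curves_in (power_lattice \<Lambda>)"
  obtains w where "w \<noteq> 0" "span (periods \<Lambda> w) = UNIV"
    "F = torus_point (power_lattice \<Lambda>) ` {s *s w |s. True}"
proof -
  obtain W where W: "vec.subspace W" "vec.dim W = 1" "span (W \<inter> power_lattice \<Lambda>) = W"
    and F: "F = torus_point (power_lattice \<Lambda>) ` W"
    using assms by (auto simp: elliptic_curves_in_def)
  obtain B where B: "B \<subseteq> W" "vec.independent B" "W \<subseteq> vec.span B" "card B = vec.dim W"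
    by (rule vec.basis_exists)
  obtain w where "B = {w}" using B(4) W(2) by (auto simp: card_1_singleton_iff)
  then have w: "w \<noteq> 0" and span: "W = {s *s w |s. True}"
    using B vec.span_minimal[OF B(1) W(1)] by (auto simp: vec.span_singleton)
  define f where "f s = s *s w" for s
  have lin: "linear f" by (auto simp: linear_iff f_def vec_eq_iff algebra_simps)
  have "inj f" using w by (auto simp: inj_def f_def)
  have "W \<inter> power_lattice \<Lambda> = f ` periods \<Lambda> w" by (auto simp: span f_def periods_def)
  then have "f ` span (periods \<Lambda> w) = range f"
    using W(3) linear_span_image[OF lin] by (auto simp: span f_def)
  then have "span (periods \<Lambda> w) = UNIV" using \<open>inj f\<close> by (simp add: inj_image_eq_iff)
  then show ?thesis using that w F span by blast
qed

section \<open>Counting\<close>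

text \<open>Balls of radius 1/2 around the points are disjoint and lie in the ball of radius r +
  1/2; compare volumes.\<close>

lemma card_separated_le:
  fixes S :: "'a::euclidean_space set"
  assumes S: "S \<subseteq> cball 0 r" and sep: "\<And>x y. x \<in> S \<Longrightarrow> y \<in> S \<Longrightarrow> x \<noteq> y \<Longrightarrow> 1 \<le> dist x y" and r: "0 \<le> r"
  shows "finite S \<and> real (card S) \<le> (2 * r + 1) ^ DIM('a)"
proof -
  define V where "V = measure lborel (ball (0::'a) 1)"
  have V: "V > 0" unfolding V_def by (rule content_ball_pos) simp
  have bound: "real (card T) \<le> (2 * r + 1) ^ DIM('a)" if T: "finite T" "T \<subseteq> S" for T
  proof -
    have "disjoint_family_on (\<lambda>x. ball x (1/2)) T"
      unfolding disjoint_family_on_def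
    proof (intro ballI impI, rule ccontr)
      fix x y assume xy: "x \<in> T" "y \<in> T" "x \<noteq> y" "ball x (1/2) \<inter> ball y (1/2) \<noteq> {}"
      then obtain z where "dist x z < 1/2" "dist y z < 1/2" by auto
      then have "dist x y < 1" using dist_triangle2[of x y z] by linarith
      then show False using sep[of x y] xy T by auto
    qed
    moreover have "ball x (1/2) \<in> fmeasurable lborel" for x :: 'a
      using emeasure_lborel_ball_finite[of x "1/2"] by (auto simp: fmeasurable_def)
    ultimately have "measure lborel (\<Union>x\<in>T. ball x (1/2)) = (\<Sum>x\<in>T. measure lborel (ball x (1/2)))"
      using T(1) by (intro measure_finite_Union) (auto simp: fmeasurable_def top.not_eq_extremum)
    also have "\<dots> = real (card T) * ((1/2) ^ DIM('a) * V)"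
      by (simp add: content_ball_conv_unit_ball[of "1/2"] V_def)
    finally have "real (card T) * ((1/2) ^ DIM('a) * V) = measure lborel (\<Union>x\<in>T. ball x (1/2))" by simp
    also have "\<dots> \<le> measure lborel (ball (0::'a) (r + 1/2))"
    proof (rule measure_mono_fmeasurable)
      show "(\<Union>x\<in>T. ball x (1/2)) \<subseteq> ball 0 (r + 1/2)"
      proof clarify
        fix x y assume "x \<in> T" "y \<in> ball x (1/2)"
        then have "norm x \<le> r" "dist x y < 1/2" using T(2) S by auto
        then show "y \<in> ball 0 (r + 1/2)" using dist_triangle[of 0 y x] by (simp add: dist_norm)
      qed
      show "ball (0::'a) (r + 1/2) \<in> fmeasurable lborel"
        using emeasure_lborel_ball_finite[of "0::'a" "r + 1/2"] by (auto simp: fmeasurable_def)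
      show "(\<Union>x\<in>T. ball x (1/2)) \<in> sets lborel" using T(1) by auto
    qed
    also have "\<dots> = (r + 1/2) ^ DIM('a) * V"
      using r by (simp add: content_ball_conv_unit_ball[of "r + 1/2"] V_def)
    finally have "real (card T) * (1/2) ^ DIM('a) \<le> (r + 1/2) ^ DIM('a)" using V by simp
    then have "real (card T) * (1/2) ^ DIM('a) * 2 ^ DIM('a) \<le> (r + 1/2) ^ DIM('a) * 2 ^ DIM('a)"
      by (intro mult_right_mono) auto
    moreover have "real (card T) * (1/2) ^ DIM('a) * 2 ^ DIM('a) = real (card T)"
      by (simp add: power_one_over)
    moreover have "(r + 1/2) ^ DIM('a) * 2 ^ DIM('a) = (2 * r + 1) ^ DIM('a)"
      by (simp add: power_mult_distrib[symmetric] distrib_right mult.commute)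
    ultimately show ?thesis by simp
  qed
  \<comment> \<open>An infinite S would contain a finite subset exceeding the bound just
    proved.\<close>
  have "finite S"
  proof (rule ccontr)
    assume "infinite S"
    then obtain T where "finite T" "T \<subseteq> S" "card T = nat \<lceil>(2 * r + 1) ^ DIM('a)\<rceil> + 1"
      by (metis infinite_arbitrarily_large)
    then show False using bound[of T] by linarith
  qed
  then show ?thesis using bound by blast
qed

text \<open>The endomorphism ring of E, each endomorphism being represented by the complex number
  through which it acts on the universal cover.\<close>

definition endomorphisms :: "complex set \<Rightarrow> complex set" where
  "endomorphisms \<Lambda> = {\<alpha>. \<forall>u\<in>\<Lambda>. \<alpha> * u \<in> \<Lambda>}"

text \<open>A nonzero endomorphism cannot shorten a shortest nonzero lattice vector.\<close>

lemma cmod_endomorphism_ge_1: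
  assumes \<Lambda>: "is_lattice \<Lambda>" and \<alpha>: "\<alpha> \<in> endomorphisms \<Lambda>" "\<alpha> \<noteq> 0"
  shows "1 \<le> cmod \<alpha>"
proof -
  obtain P where P: "fundamental_domain \<Lambda> P" "bounded P"
    by (rule lattice_fundamental_domain[OF \<Lambda>])
  \<comment> \<open>Without a nonzero lattice vector the fundamental domain would be the whole
    plane, contradicting its boundedness.\<close>
  obtain z where z: "z \<in> \<Lambda>" "z \<noteq> 0"
  proof (rule ccontr)
    assume "\<not> thesis"
    then have "\<Lambda> \<subseteq> {0}" using that by blast
    then have "z \<in> P" for z using P(1) unfolding fundamental_domain_def by (metis diff_zero singletonD subsetD)
    then have "P = UNIV" by blast
    then show False using P(2) not_bounded_UNIV by blast
  qed
  define S where "S = \<Lambda> \<inter> cball 0 (cmod z) - {0}"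
  have S: "finite S" "S \<noteq> {}" using finite_lattice_Int_cball[OF \<Lambda>] z by (auto simp: S_def)
  obtain u where u: "u \<in> S" "\<And>v. v \<in> S \<Longrightarrow> cmod u \<le> cmod v"
    using ex_is_arg_min_if_finite[OF S, of cmod] by (auto simp: is_arg_min_linorder)
  have "\<alpha> * u \<in> \<Lambda>" "\<alpha> * u \<noteq> 0" using u(1) \<alpha> by (auto simp: S_def endomorphisms_def)
  \<comment> \<open>If \<alpha> u is not in S, it is longer than z, hence longer than u.\<close>
  then have "cmod u \<le> cmod (\<alpha> * u)"
    using u(1) u(2)[of "\<alpha> * u"] by (cases "\<alpha> * u \<in> S") (auto simp: S_def)
  then show ?thesis using u(1) by (simp add: norm_mult S_def)
qed

text \<open>Differences of endomorphisms are endomorphisms, so distinct ones have distance at least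
  1. The exponent is the real dimension of the plane, and -1 removes the zero endomorphism.\<close>

lemma card_endomorphisms_le:
  assumes \<Lambda>: "is_lattice \<Lambda>" and r: "0 \<le> r"
  shows "finite (endomorphisms \<Lambda> \<inter> cball 0 r - {0})"
    and "real (card (endomorphisms \<Lambda> \<inter> cball 0 r - {0})) \<le> (2 * r + 1) ^ 2 - 1"
proof -
  let ?S = "endomorphisms \<Lambda> \<inter> cball 0 r"
  note sub = lattice_add_subgroup[OF \<Lambda>]
  have "1 \<le> dist x y" if "x \<in> ?S" "y \<in> ?S" "x \<noteq> y" for x y
  proof -
    have "x - y \<in> endomorphisms \<Lambda>"
      using that add_subgroup_diff[OF sub] by (auto simp: endomorphisms_def left_diff_distrib)
    then show ?thesis using cmod_endomorphism_ge_1[OF \<Lambda>, of "x - y"] that by (simp add: dist_norm)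
  qed
  then have S: "finite ?S" "real (card ?S) \<le> (2 * r + 1) ^ 2"
    using card_separated_le[of ?S r] r by auto
  show "finite (?S - {0})" using S by simp
  have "0 \<in> ?S" using r add_subgroup_zero[OF sub] by (auto simp: endomorphisms_def)
  then have "real (card (?S - {0})) = real (card ?S) - 1"
    using card_Suc_Diff1[OF S(1), of 0] by linarith
  then show "real (card (?S - {0})) \<le> (2 * r + 1) ^ 2 - 1" using S(2) by simp
qed

section \<open>Encoding and counting the curves\<close>

lemma line_axis:
  fixes w :: "complex^2"
  assumes "w \<noteq> 0" "w $ i = 0" "j \<noteq> i"
  shows "{s *s w |s. True} = {s *s axis j 1 |s. True}"
proof -
  have w: "w = (w $ j) *s axis j 1"
    using assms exhaust_2[of i] exhaust_2[of j] by (auto simp: vec_eq_iff forall_2 axis_def)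
  then have j: "w $ j \<noteq> 0" using assms(1) by auto
  show ?thesis
  proof (intro set_eqI iffI)
    fix v assume "v \<in> {s *s w |s. True}"
    then obtain s where "v = s *s w" by blast
    then have "v = (s * w $ j) *s axis j 1" by (subst (asm) w) simp
    then show "v \<in> {s *s axis j 1 |s. True}" by blast
  next
    fix v :: "complex^2" assume "v \<in> {s *s axis j 1 |s. True}"
    then obtain s where "v = s *s axis j 1" by blast
    then have "v = (s / w $ j) *s w" using j by (subst w) simp
    then show "v \<in> {s *s w |s. True}" by blast
  qed
qed

lemma line_eq_if_slope_eq:
  fixes v w :: "complex^2"
  assumes "v $ i \<noteq> 0" "w $ i \<noteq> 0" "i \<noteq> j" "v $ j / v $ i = w $ j / w $ i"
  shows "{s *s v |s. True} = {s *s w |s. True}"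
proof -
  have sub: "{s *s v |s. True} \<subseteq> {s *s w |s. True}"
    if "v $ i \<noteq> 0" "w $ i \<noteq> 0" "v $ j / v $ i = w $ j / w $ i" for v w :: "complex^2"
  proof -
    have "v = (v $ i / w $ i) *s w"
      using that \<open>i \<noteq> j\<close> exhaust_2[of i] exhaust_2[of j] by (auto simp: vec_eq_iff forall_2 field_simps)
    then have "s *s v = (s * (v $ i / w $ i)) *s w" for s by (metis vector_smult_assoc)
    then show ?thesis by blast
  qed
  show ?thesis using sub[of v w] sub[of w v] assms by simp
qed


text \<open>A curve off the axes is encoded by its degree d over the i-th factor and by its slope
  multiplied by d, which is an endomorphism. The degree e over the other factor survives only in the
  bound on \<open>cmod \<alpha>\<close>.\<close>

lemma elliptic_curve_of_degree_le_cases: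
  fixes F :: "(complex^2) set set" and m :: "2 \<Rightarrow> nat"
  assumes \<Lambda>: "is_lattice \<Lambda>" and m: "\<And>i. m i > 0" and ij: "i \<noteq> j"
    and F: "F \<in> elliptic_curves_of_degree_le \<Lambda> m t"
  obtains (axis) k where "F = torus_point (power_lattice \<Lambda>) ` {s *s axis k 1 |s. True}"
  | (line) w :: "complex^2" and d \<alpha> where "F = torus_point (power_lattice \<Lambda>) ` {s *s w |s. True}" "w $ i \<noteq> 0"
      "0 < d" "m i * d \<le> t" "\<alpha> = of_nat d * (w $ j / w $ i)" "\<alpha> \<in> endomorphisms \<Lambda>" "\<alpha> \<noteq> 0"
      "cmod \<alpha> \<le> real t / sqrt (real (m i * m j)) / 2"
proof -
  have UNIV: "(UNIV :: 2 set) = {i, j}" using ij exhaust_2[of i] exhaust_2[of j] by (auto simp: UNIV_2)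
  obtain w where w: "w \<noteq> 0" and span: "span (periods \<Lambda> w) = UNIV"
    and Fw: "F = torus_point (power_lattice \<Lambda>) ` {s *s w |s. True}"
    using F elliptic_curve_line unfolding elliptic_curves_of_degree_le_def by blast
  show ?thesis
  proof (cases "w $ i = 0 \<or> w $ j = 0")
    case True
    then obtain k l where "w $ k = 0" "l \<noteq> k" using ij by metis
    then show ?thesis using axis[of l] line_axis[OF w, of k l] Fw by simp
  next
    case False
    define d where "d = projection_degree \<Lambda> w i"
    define e where "e = projection_degree \<Lambda> w j"
    define \<alpha> where "\<alpha> = of_nat d * (w $ j / w $ i)"
    have d: "d > 0" unfolding d_def using False by (intro projection_degree_pos[OF \<Lambda> span]) auto
    have "\<And>k. w $ k \<noteq> 0" using False UNIV by (metis UNIV_I insertE singletonD)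
    then have "int (m i) * int d + int (m j) * int e \<le> int t"
      using F intersection_number_line[OF \<Lambda> m w span Fw] ij
      by (simp add: elliptic_curves_of_degree_le_def UNIV d_def e_def)
    then have deg: "m i * d + m j * e \<le> t" by (metis of_nat_add of_nat_le_iff of_nat_mult)
    have "real d * (cmod (w $ j))\<^sup>2 = real e * (cmod (w $ i))\<^sup>2"
      unfolding d_def e_def using False by (intro projection_degree_ratio[OF \<Lambda> span]) auto
    then have "(cmod \<alpha>)\<^sup>2 = real d * real e"
      using False by (simp add: \<alpha>_def norm_mult norm_divide power_mult_distrib power_divide field_simps power2_eq_square)
    then have "(2 * sqrt (real (m i * m j)) * cmod \<alpha>)\<^sup>2 = 4 * (real (m i * d) * real (m j * e))"
      by (simp add: power_mult_distrib)
    \<comment> \<open>The inequality of arithmetic and geometric means for the two contributions to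
      the degree.\<close>
    also have "\<dots> \<le> (real (m i * d) + real (m j * e))\<^sup>2"
      using zero_le_power2[of "real (m i * d) - real (m j * e)"] by (simp add: power2_eq_square algebra_simps)
    also have "\<dots> \<le> (real t)\<^sup>2"
    proof (rule power_mono)
      show "real (m i * d) + real (m j * e) \<le> real t" using deg by (metis of_nat_add of_nat_le_iff)
    qed simp
    finally have "2 * sqrt (real (m i * m j)) * cmod \<alpha> \<le> real t" by (rule power2_le_imp_le) simp
    then have "cmod \<alpha> \<le> real t / sqrt (real (m i * m j)) / 2"
      using m[of i] m[of j] by (simp add: field_simps)
    moreover have "\<alpha> \<in> endomorphisms \<Lambda>"
      unfolding endomorphisms_def \<alpha>_def d_def using projection_degree_endomorphism[OF \<Lambda> span, of i] False by blast
    moreover have "\<alpha> \<noteq> 0" using False d by (simp add: \<alpha>_def)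
    ultimately show ?thesis using line[OF Fw _ d _ \<alpha>_def] False deg by auto
  qed
qed

lemma card_elliptic_curves_of_degree_le:
  fixes m :: "2 \<Rightarrow> nat" and t :: nat
  assumes \<Lambda>: "is_lattice \<Lambda>" and m: "\<And>i. m i > 0" and ij: "i \<noteq> j" "m j \<le> m i"
  defines "X \<equiv> elliptic_curves_of_degree_le \<Lambda> m t" and "T \<equiv> real t / sqrt (real (m i * m j))"
  shows "finite X \<and> real (card X) \<le> 2 + T * ((T + 1)\<^sup>2 - 1)"
proof -
  define axes where "axes = (\<lambda>k::2. torus_point (power_lattice \<Lambda>) ` {s *s axis k 1 |s. True}) ` UNIV"
  define E where "E = endomorphisms \<Lambda> \<inter> cball 0 (T / 2) - {0}"
  define R where "R p F \<longleftrightarrow> (\<exists>w::complex^2. F = torus_point (power_lattice \<Lambda>) ` {s *s w |s. True} \<and> w $ i \<noteq> 0 \<and>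
      0 < fst p \<and> snd p = of_nat (fst p) * (w $ j / w $ i))" for p F
  define D where "D = {1..t div m i} \<times> E"
  have T: "0 \<le> T" by (simp add: T_def)
  have E: "finite E" "real (card E) \<le> (T + 1)\<^sup>2 - 1"
    using card_endomorphisms_le[OF \<Lambda>, of "T / 2"] T by (auto simp: E_def)
  \<comment> \<open>The slope of the line is the quotient \<open>snd p / fst p\<close>, and it
    determines the line.\<close>
  have R_unique: "F = F'" if RF: "R p F" and RF': "R p F'" for p F F'
  proof -
    obtain v :: "complex^2" where v: "F = torus_point (power_lattice \<Lambda>) ` {s *s v |s. True}" "v $ i \<noteq> 0"
      "0 < fst p" "snd p = of_nat (fst p) * (v $ j / v $ i)" using RF unfolding R_def by blast
    obtain w :: "complex^2" where w: "F' = torus_point (power_lattice \<Lambda>) ` {s *s w |s. True}" "w $ i \<noteq> 0"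
      "snd p = of_nat (fst p) * (w $ j / w $ i)" using RF' unfolding R_def by blast
    have "v $ j / v $ i = w $ j / w $ i"
      using v(3,4) w(3) by (metis less_numeral_extra(3) mult_left_cancel of_nat_eq_0_iff)
    then show ?thesis unfolding v(1) w(1) using line_eq_if_slope_eq[OF v(2) w(2) ij(1)] by simp
  qed
  have sub: "X \<subseteq> axes \<union> (\<lambda>p. THE F. R p F) ` D"
  proof
    fix F assume "F \<in> X"
    then have F: "F \<in> elliptic_curves_of_degree_le \<Lambda> m t" by (simp add: X_def)
    show "F \<in> axes \<union> (\<lambda>p. THE F. R p F) ` D"
    proof (cases rule: elliptic_curve_of_degree_le_cases[OF \<Lambda> m ij(1) F, case_names axis line])
      case (axis k)
      then show ?thesis by (auto simp: axes_def)
    next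
      case (line w d \<alpha>)
      then have "R (d, \<alpha>) F" by (auto simp: R_def)
      \<comment> \<open>By uniqueness the description returns F itself, so D together with the axes
        covers X.\<close>
      then have "(THE F. R (d, \<alpha>) F) = F" by (rule the_equality) (rule R_unique[OF _ \<open>R (d, \<alpha>) F\<close>])
      moreover have "(d, \<alpha>) \<in> D"
        using line m[of i] by (auto simp: D_def E_def T_def less_eq_div_iff_mult_less_eq mult.commute)
      ultimately show ?thesis by (metis UnCI image_eqI)
    qed
  qed
  have fin: "finite axes" "finite D" by (auto simp: axes_def D_def E)
  have "card axes \<le> 2" unfolding axes_def by (rule order_trans[OF card_image_le]) auto
  then have "card X \<le> 2 + card D"
    using fin card_mono[OF _ sub] card_Un_le[of axes "(\<lambda>p. THE F. R p F) ` D"] card_image_le[OF fin(2), of "\<lambda>p. THE F. R p F"]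
    by fastforce
  \<comment> \<open>Here the ordering \<open>m j \<le> m i\<close> enters: it makes the geometric
    mean of the two weights at most \<open>m i\<close>.\<close>
  moreover have "real (t div m i) \<le> T"
  proof -
    have "sqrt (real (m i * m j)) \<le> sqrt ((real (m i))\<^sup>2)"
      using ij(2) by (intro real_sqrt_le_mono) (simp add: power2_eq_square mult_left_mono)
    then have "sqrt (real (m i * m j)) \<le> real (m i)" by simp
    then have "real t / real (m i) \<le> T" unfolding T_def using m[of i] m[of j] by (intro divide_left_mono) auto
    then show ?thesis using of_nat_div_le_of_nat[of t "m i", where ?'a = real] by linarith
  qed
  then have "real (card D) \<le> T * ((T + 1)\<^sup>2 - 1)"
    using E T by (auto simp: D_def card_cartesian_product intro!: mult_mono)
  ultimately show ?thesis using finite_subset[OF sub] fin by auto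
qed

theorem proposition5p1:
  fixes \<Lambda> :: "complex set" and m :: "2 \<Rightarrow> nat"
  assumes "is_lattice \<Lambda>" and "\<And>i. m i > 0"
  shows "\<exists>(C :: real) (q :: nat \<Rightarrow> real).
           C = 4 / sqrt (real (m 1 * m 2)) ^ 3 \<and>
           q = (\<lambda>t. 2 + 2 * real t ^ 2 / real (m 1 * m 2)) \<and>
           q \<in> O(\<lambda>t. real t ^ 2) \<and>
           (\<forall>t\<ge>1. finite (elliptic_curves_of_degree_le \<Lambda> m t :: (complex^2) set set set) \<and>
              real (card (elliptic_curves_of_degree_le \<Lambda> m t :: (complex^2) set set set))
                \<le> C * real t ^ 3 + q t)"
proof (intro exI conjI allI impI)
  show "(\<lambda>t. 2 + 2 * real t ^ 2 / real (m 1 * m 2)) \<in> O(\<lambda>t. real t ^ 2)"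
  \<comment> \<open>For t at least 1 the constant term 2 is at most 2 t^2, which accounts for the
    first summand of the witness.\<close>
  proof (rule bigoI[where c = "2 + 2 / real (m 1 * m 2)"])
    show "\<forall>\<^sub>F t in sequentially. norm (2 + 2 * real t ^ 2 / real (m 1 * m 2)) \<le>
        (2 + 2 / real (m 1 * m 2)) * norm (real t ^ 2)"
      using eventually_ge_at_top[of 1] by eventually_elim (simp add: distrib_right one_le_power)
  qed
next
  fix t :: nat
  define T where "T = real t / sqrt (real (m 1 * m 2))"
  let ?X = "elliptic_curves_of_degree_le \<Lambda> m t :: (complex^2) set set set"
  note count = card_elliptic_curves_of_degree_le[where \<Lambda> = \<Lambda> and m = m and t = t, OF assms(1) assms(2)]
  \<comment> \<open>T is symmetric in the two weights, so the factor with the larger weight may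
    serve as i.\<close>
  have T': "T = real t / sqrt (real (m 2 * m 1))" by (simp add: T_def mult.commute)
  have X: "finite ?X \<and> real (card ?X) \<le> 2 + T * ((T + 1)\<^sup>2 - 1)"
  proof (cases "m 2 \<le> m 1")
    case True
    then show ?thesis unfolding T_def by (intro count) auto
  next
    case False
    then show ?thesis unfolding T' by (intro count) auto
  qed
  then show "finite ?X" by blast
  have "2 + T * ((T + 1)\<^sup>2 - 1) = T ^ 3 + (2 + 2 * T\<^sup>2)"
    by (simp add: power2_eq_square power3_eq_cube algebra_simps)
  \<comment> \<open>The count gives T^3 as its cubic term; the factor 4 of the stated C leaves room
    to spare.\<close>
  also have "\<dots> \<le> 4 * T ^ 3 + (2 + 2 * T\<^sup>2)" by (simp add: T_def)
  also have "\<dots> = 4 / sqrt (real (m 1 * m 2)) ^ 3 * real t ^ 3 + (2 + 2 * real t ^ 2 / real (m 1 * m 2))"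
    by (simp add: T_def power_divide)
  finally show "real (card ?X) \<le> 4 / sqrt (real (m 1 * m 2)) ^ 3 * real t ^ 3 + (2 + 2 * real t ^ 2 / real (m 1 * m 2))"
    using X by linarith
qed simp_all

end
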